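(* Let $n\ge 0$ and let $\alpha\in\mathrm{UPF}_n$ have associated car sets $\phi(\alpha)=(I_1,\dots,I_m)$. For $j\in[m]$ let $\mu_j:=\min I_j$ (the leader of block $j$). Then $\alpha\in\mathrm{DUPF}_n$ if and only if, for every $j\in[m]$, the leader $\mu_j$ is not the $j$-th smallest element among $\mu_1,\dots,\mu_m$.
   Context: $[n]=\{1,\dots,n\}$. A tuple $\alpha=(a_1,\dots,a_n)\in[n]^n$ is a parking function if, when cars $1,\dots,n$ enter in this order a one-way street with spots $1,\dots,n$ and car $i$ parks in the first free spot $s_i\ge a_i$, all cars manage to park. $\mathrm{UPF}_n$ (unit-interval parking functions) is the set of parking functions of length $n$ with $s_i-a_i\in\{0,1\}$ for all $i$; $\mathrm{UPF}_0$ consists of the empty tuple. Block structure: for $\alpha\in\mathrm{UPF}_n$ let $(a^\uparrow_1,\dots,a^\uparrow_n)$ be its weakly increasing rearrangement, let $\nu_1<\dots<\nu_m$ be the indices $i$ with $a^\uparrow_i=i$ (block starts), put $\nu_{m+1}=n+1$, $\ell_j=\nu_{j+1}-\nu_j$ (length of block $j$), and $m(\alpha)=m$. The car set of block $j$ is $I_j=\{i\in[n]:\nu_j\le a_i<\nu_{j+1}\}$, and $|I_j|=\ell_j$. Set $\phi(\alpha)=(I_1,\dots,I_m)$, an ordered set partition of $[n]$. An ordered set partition $(C_1,\dots,C_k)$ of $[n]$ (nonempty disjoint blocks with union $[n]$), whose blocks listed by increasing minimum element are $B_1,\dots,B_k$, is deranged if $C_i\ne B_i$ for all $i\in[k]$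 (the empty ordered set partition of $\emptyset$ is deranged). $\mathrm{DUPF}_n$ is the set of $\alpha\in\mathrm{UPF}_n$ such that $\phi(\alpha)$ is deranged. *)

theory Defs
  imports Main
begin

text \<open>
  A tuple \<open>(a\<^sub>1, \<dots>, a\<^sub>n)\<close> is a list of length \<open>n\<close>. Cars, spots, blocks and their indices are all
  numbered from 1, so the \<open>i\<close>-th entry of a list \<open>xs\<close> is \<open>xs ! (i - 1)\<close>.
\<close>

text \<open>
  \<open>F\<close> is the set of occupied spots. The street ends at spot \<open>n\<close>, so a car may find no spot.
\<close>

definition first_free :: "nat \<Rightarrow> nat set \<Rightarrow> nat \<Rightarrow> nat option" where
  "first_free n F a =
     (if \<exists>s\<in>{1..n}. a \<le> s \<and> s \<notin> F
      then Some (LEAST s. s \<in> {1..n} \<and> a \<le> s \<and> s \<notin> F)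
      else None)"

text \<open>
  The list of spots taken by the successive cars, or \<open>None\<close> if some car fails to park.
\<close>

fun park :: "nat \<Rightarrow> nat set \<Rightarrow> nat list \<Rightarrow> nat list option" where
  "park n F [] = Some []"
| "park n F (a # as) =
     (case first_free n F a of
        None \<Rightarrow> None
      | Some s \<Rightarrow> map_option (\<lambda>ss. s # ss) (park n (insert s F) as))"

definition parking_function :: "nat \<Rightarrow> nat list \<Rightarrow> bool" where
  "parking_function n \<alpha> \<longleftrightarrow>
     length \<alpha> = n \<and> set \<alpha> \<subseteq> {1..n} \<and> park n {} \<alpha> \<noteq> None"

definition UPF :: "nat \<Rightarrow> nat list set" where
  "UPF n = {\<alpha>. parking_function n \<alpha> \<and>
     (\<forall>i\<in>{1..n}. int (the (park n {} \<alpha>) ! (i - 1)) - int (\<alpha> ! (i - 1)) \<in> {0, 1})}"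

definition block_starts :: "nat list \<Rightarrow> nat list" where
  "block_starts \<alpha> = filter (\<lambda>i. sort \<alpha> ! (i - 1) = i) [1..<length \<alpha> + 1]"

definition num_blocks :: "nat list \<Rightarrow> nat" where
  "num_blocks \<alpha> = length (block_starts \<alpha>)"

text \<open>
  \<open>\<nu>\<^sub>j\<close> for \<open>1 \<le> j \<le> m + 1\<close>, where \<open>m\<close> is the number of blocks and \<open>\<nu>\<^bsub>m+1\<^esub> = n + 1\<close>.
\<close>

definition block_start :: "nat list \<Rightarrow> nat \<Rightarrow> nat" where
  "block_start \<alpha> j = (block_starts \<alpha> @ [length \<alpha> + 1]) ! (j - 1)"

definition car_set :: "nat list \<Rightarrow> nat \<Rightarrow> nat set" where
  "car_set \<alpha> j = {i \<in> {1..length \<alpha>}.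
     block_start \<alpha> j \<le> \<alpha> ! (i - 1) \<and> \<alpha> ! (i - 1) < block_start \<alpha> (j + 1)}"

definition phi :: "nat list \<Rightarrow> nat set list" where
  "phi \<alpha> = map (car_set \<alpha>) [1..<num_blocks \<alpha> + 1]"

definition ordered_set_partition :: "nat \<Rightarrow> nat set list \<Rightarrow> bool" where
  "ordered_set_partition n Cs \<longleftrightarrow>
     (\<forall>C\<in>set Cs. C \<noteq> {}) \<and>
     (\<forall>i<length Cs. \<forall>j<length Cs. i \<noteq> j \<longrightarrow> Cs ! i \<inter> Cs ! j = {}) \<and>
     \<Union>(set Cs) = {1..n}"

definition deranged :: "nat \<Rightarrow> nat set list \<Rightarrow> bool" where
  "deranged n Cs \<longleftrightarrow>
     ordered_set_partition n Cs \<and>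
     (\<forall>i\<in>{1..length Cs}. Cs ! (i - 1) \<noteq> sort_key Min Cs ! (i - 1))"

definition DUPF :: "nat \<Rightarrow> nat list set" where
  "DUPF n = {\<alpha> \<in> UPF n. deranged n (phi \<alpha>)}"

definition leader :: "nat list \<Rightarrow> nat \<Rightarrow> nat" where
  "leader \<alpha> j = Min (phi \<alpha> ! (j - 1))"

end

theory Submission
  imports Defs "HOL-Library.Multiset"
begin

text \<open>
  The car sets are nonempty and pairwise disjoint, so each of them is determined by its minimum:
  comparing \<open>C\<^sub>i\<close> with \<open>B\<^sub>i\<close> amounts to comparing the leader of block \<open>i\<close> with the \<open>i\<close>-th smallest leader.
  Since \<open>deranged\<close> also demands an ordered set partition, the car sets must cover all cars. This
  holds because the first block starts at 1: only a car preferring spot 1 can park there.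
\<close>

lemma first_free_SomeD:
  assumes "first_free n F a = Some s"
  shows "s \<in> {1..n}" "a \<le> s" "s \<notin> F"
proof -
  from assms have "\<exists>s. s \<in> {1..n} \<and> a \<le> s \<and> s \<notin> F"
    and s: "s = (LEAST s. s \<in> {1..n} \<and> a \<le> s \<and> s \<notin> F)"
    by (auto simp: first_free_def split: if_splits)
  from LeastI_ex[OF this(1)] show "s \<in> {1..n}" "a \<le> s" "s \<notin> F"
    unfolding s by blast+
qed

text \<open>Induction with \<open>F\<close> arbitrary, since parking a car enlarges the occupied
  set. Excluding \<open>F\<close> from the remaining spots is what yields distinctness in the
  inductive step.\<close>

lemma park_SomeD:
  assumes "park n F as = Some ss"
  shows "list_all2 (\<le>) as ss \<and> distinct ss \<and> set ss \<subseteq> {1..n} - F"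
  using assms
proof (induction as arbitrary: F ss)
  case (Cons a as)
  then obtain s ss' where s: "first_free n F a = Some s"
    and p: "park n (insert s F) as = Some ss'" "ss = s # ss'"
    by (auto split: option.splits)
  show ?case
    using Cons.IH[OF p(1)] first_free_SomeD[OF s] p(2) by auto
qed simp

text \<open>Pigeonhole: \<open>n\<close> distinct spots inside \<open>{1..n}\<close> fill the
  street. The car parked in spot 1 prefers a spot no later than its own, which leaves only
  1.\<close>

lemma parking_function_one_mem:
  assumes "parking_function n \<alpha>" "n \<noteq> 0"
  shows "1 \<in> set \<alpha>"
proof -
  from assms obtain ss where len: "length \<alpha> = n" and range: "set \<alpha> \<subseteq> {1..n}"
    and "park n {} \<alpha> = Some ss"
    by (auto simp: parking_function_def)
  from park_SomeD[OF this(3)] have ss: "list_all2 (\<le>) \<alpha> ss" "distinct ss" "set ss \<subseteq> {1..n}"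
    by auto
  have "card (set ss) = card {1..n}"
    using ss len by (simp add: distinct_card list_all2_lengthD[symmetric])
  then have "set ss = {1..n}"
    using ss(3) by (intro card_subset_eq) auto
  then have "1 \<in> set ss"
    using assms(2) by auto
  then obtain i where i: "i < length ss" "ss ! i = 1"
    by (auto simp: in_set_conv_nth)
  then have "\<alpha> ! i \<le> 1" "i < length \<alpha>"
    using ss(1) by (auto simp: list_all2_conv_all_nth)
  moreover from this(2) range have "\<alpha> ! i \<ge> 1"
    by (meson atLeastAtMost_iff nth_mem subsetD)
  ultimately show ?thesis
    by (metis nth_mem le_antisym)
qed

text \<open>Makes 1 pass the filter in \<open>block_starts\<close>: it occurs in \<alpha>, and no
  entry is smaller.\<close>

lemma sort_nth_0_eq_1:
  assumes "parking_function n \<alpha>" "n \<noteq> 0"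
  shows "sort \<alpha> ! 0 = 1"
proof -
  have one: "1 \<in> set (sort \<alpha>)"
    using parking_function_one_mem[OF assms] by simp
  then obtain i where "i < length (sort \<alpha>)" "sort \<alpha> ! i = 1"
    by (metis in_set_conv_nth)
  then have "sort \<alpha> ! 0 \<le> 1" "sort \<alpha> ! 0 \<in> set \<alpha>"
    using sorted_nth_mono[OF sorted_sort, of 0 i \<alpha>]
    by (simp, metis nth_mem set_sort gr_zeroI not_less0 less_trans)
  then show ?thesis
    using assms(1) by (force simp: parking_function_def)
qed

text \<open>The sentinel \<open>length \<alpha> + 1\<close> exceeds every candidate index, so
  appending it keeps the list strictly increasing; hence \<open>j\<close> may be
  \<open>num_blocks \<alpha> + 1\<close>.\<close>

lemma block_start_less:
  assumes "1 \<le> i" "i < j" "j \<le> num_blocks \<alpha> + 1"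
  shows "block_start \<alpha> i < block_start \<alpha> j"
proof -
  have "sorted_wrt (<) (block_starts \<alpha> @ [length \<alpha> + 1])"
    by (auto simp: block_starts_def sorted_wrt_append simp del: upt_Suc intro!: sorted_wrt_filter)
  then show ?thesis
    unfolding block_start_def
    by (rule sorted_wrt_nth_less) (use assms in \<open>auto simp: num_blocks_def\<close>)
qed

lemma block_start_mono:
  assumes "1 \<le> i" "i \<le> j" "j \<le> num_blocks \<alpha> + 1"
  shows "block_start \<alpha> i \<le> block_start \<alpha> j"
  using block_start_less[of i j \<alpha>] assms by (cases "i = j") auto

text \<open>By the filter condition, a block start is itself an entry of the sorted tuple.\<close>

lemma block_start_mem:
  assumes "j \<in> {1..num_blocks \<alpha>}"
  shows "block_start \<alpha> j \<in> set \<alpha>"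
proof -
  have "block_start \<alpha> j = block_starts \<alpha> ! (j - 1)" "j - 1 < length (block_starts \<alpha>)"
    using assms by (auto simp: block_start_def num_blocks_def nth_append)
  then have "block_start \<alpha> j \<in> set (block_starts \<alpha>)"
    by simp
  then have "sort \<alpha> ! (block_start \<alpha> j - 1) = block_start \<alpha> j"
    "block_start \<alpha> j - 1 < length (sort \<alpha>)"
    by (auto simp: block_starts_def)
  then show ?thesis
    by (metis nth_mem set_sort)
qed

lemma block_start_1:
  assumes "parking_function n \<alpha>"
  shows "block_start \<alpha> 1 = 1"
proof (cases "n = 0")
  case True
  \<comment> \<open>There are no blocks here, and the value is the sentinel
    \<open>length \<alpha> + 1 = 1\<close>.\<close>
  then show ?thesis
    using assms by (simp add: parking_function_def block_start_def block_starts_def)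
next
  case False
  moreover have "length \<alpha> = n"
    using assms by (simp add: parking_function_def)
  \<comment> \<open>The candidate list begins with 1, which the filter keeps.\<close>
  ultimately have "block_starts \<alpha> \<noteq> [] \<and> hd (block_starts \<alpha>) = 1"
    using sort_nth_0_eq_1[OF assms]
    by (simp add: block_starts_def upt_conv_Cons del: upt_Suc)
  then show ?thesis
    by (cases "block_starts \<alpha>") (auto simp: block_start_def)
qed

lemma block_start_last: "block_start \<alpha> (num_blocks \<alpha> + 1) = length \<alpha> + 1"
  by (simp add: block_start_def num_blocks_def nth_append)

lemma ex_block:
  assumes "block_start \<alpha> 1 \<le> x" "x < block_start \<alpha> (num_blocks \<alpha> + 1)"
  shows "\<exists>j\<in>{1..num_blocks \<alpha>}. block_start \<alpha> j \<le> x \<and> x < block_start \<alpha> (j + 1)"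
proof -
  \<comment> \<open>The block containing \<open>x\<close> is the first one whose successor starts
    beyond \<open>x\<close>; \<open>num_blocks \<alpha>\<close> witnesses that such an index exists.
    By minimality, block \<open>k\<close> itself does not start beyond \<open>x\<close>.\<close>
  define k where "k = (LEAST k. x < block_start \<alpha> (k + 1))"
  have k: "x < block_start \<alpha> (k + 1)" "k \<le> num_blocks \<alpha>"
    unfolding k_def using assms(2) by (auto intro: LeastI Least_le)
  have "k \<noteq> 0"
    using k(1) assms(1) by (intro notI) simp
  then have "\<not> x < block_start \<alpha> (k - 1 + 1)"
    unfolding k_def by (intro not_less_Least) simp
  with k \<open>k \<noteq> 0\<close> show ?thesis
    by (intro bexI[of _ k]) auto
qed

text \<open>Some car prefers exactly the first spot of the block. The witness is
  \<open>i + 1\<close> because cars are numbered from 1 and list positions from 0.\<close>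

lemma car_set_nonempty:
  assumes "j \<in> {1..num_blocks \<alpha>}"
  shows "car_set \<alpha> j \<noteq> {}"
proof -
  from block_start_mem[OF assms] obtain i where "i < length \<alpha>" "\<alpha> ! i = block_start \<alpha> j"
    by (auto simp: in_set_conv_nth)
  moreover have "block_start \<alpha> j < block_start \<alpha> (j + 1)"
    using assms by (intro block_start_less) auto
  ultimately have "i + 1 \<in> car_set \<alpha> j"
    by (simp add: car_set_def)
  then show ?thesis by blast
qed

lemma car_set_disjoint:
  assumes "i \<in> {1..num_blocks \<alpha>}" "j \<in> {1..num_blocks \<alpha>}" "i \<noteq> j"
  shows "car_set \<alpha> i \<inter> car_set \<alpha> j = {}"
proof -
  \<comment> \<open>By symmetry take \<open>i < j\<close>: preferences in block \<open>i\<close> lie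
    below \<open>block_start \<alpha> (i + 1)\<close>, which is at most
    \<open>block_start \<alpha> j\<close>.\<close>
  have "car_set \<alpha> i \<inter> car_set \<alpha> j = {}"
    if "i < j" "i \<in> {1..num_blocks \<alpha>}" "j \<in> {1..num_blocks \<alpha>}" for i j
    using block_start_mono[of "i + 1" j \<alpha>] that by (auto simp: car_set_def)
  then show ?thesis
    using assms by (metis Int_commute linorder_neqE_nat)
qed

lemma length_phi: "length (phi \<alpha>) = num_blocks \<alpha>"
  by (simp add: phi_def)

lemma phi_nth: "i < num_blocks \<alpha> \<Longrightarrow> phi \<alpha> ! i = car_set \<alpha> (i + 1)"
  by (simp add: phi_def del: upt_Suc)

lemma ordered_set_partition_phi:
  assumes "parking_function n \<alpha>"
  shows "ordered_set_partition n (phi \<alpha>)"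
proof -
  have len: "length \<alpha> = n" and range: "set \<alpha> \<subseteq> {1..n}"
    using assms by (auto simp: parking_function_def)
  have "i \<in> \<Union>(set (phi \<alpha>))" if "i \<in> {1..n}" for i
  proof -
    have "\<alpha> ! (i - 1) \<in> {1..n}"
      using that len range by (intro subsetD[OF range] nth_mem) auto
    \<comment> \<open>The first block starts at 1 and the sentinel is \<open>n + 1\<close>, so every
      preference falls between them and \<open>ex_block\<close> applies.\<close>
    then obtain j where "j \<in> {1..num_blocks \<alpha>}" "block_start \<alpha> j \<le> \<alpha> ! (i - 1)"
      "\<alpha> ! (i - 1) < block_start \<alpha> (j + 1)"
      using ex_block[of \<alpha> "\<alpha> ! (i - 1)"] block_start_1[OF assms] block_start_last[of \<alpha>] len
      by auto
    then show ?thesis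
      using that len by (auto simp: phi_def car_set_def simp del: upt_Suc)
  qed
  moreover have "\<Union>(set (phi \<alpha>)) \<subseteq> {1..n}"
    by (auto simp: phi_def car_set_def len simp del: upt_Suc)
  ultimately have "\<Union>(set (phi \<alpha>)) = {1..n}"
    by blast
  moreover have "C \<noteq> {}" if "C \<in> set (phi \<alpha>)" for C
    using that car_set_nonempty by (auto simp: phi_def simp del: upt_Suc)
  moreover have "phi \<alpha> ! i \<inter> phi \<alpha> ! j = {}"
    if "i < length (phi \<alpha>)" "j < length (phi \<alpha>)" "i \<noteq> j" for i j
    using that by (simp add: length_phi phi_nth car_set_disjoint)
  ultimately show ?thesis
    by (simp add: ordered_set_partition_def)
qed

text \<open>Two blocks with the same minimum share that element. Disjointness is stated for distinct
  indices, so they occupy the same index and coincide.\<close>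

lemma inj_on_Min_ordered_set_partition:
  assumes "ordered_set_partition n Cs"
  shows "inj_on Min (set Cs)"
proof (rule inj_onI)
  fix C D assume CD: "C \<in> set Cs" "D \<in> set Cs" "Min C = Min D"
  \<comment> \<open>Both facts are needed for \<open>Min E\<close> to be an element of
    \<open>E\<close>.\<close>
  have "finite E \<and> E \<noteq> {}" if "E \<in> set Cs" for E
  proof -
    have "E \<subseteq> {1..n}"
      using that assms by (auto simp: ordered_set_partition_def)
    then show ?thesis
      using that assms finite_subset by (auto simp: ordered_set_partition_def)
  qed
  with CD have "Min C \<in> C \<inter> D"
    by (metis IntI Min_in)
  with CD(1,2) assms show "C = D"
    unfolding ordered_set_partition_def by (metis empty_iff in_set_conv_nth)
qed

text \<open>The left side is sorted and has the same multiset of entries as \<open>map f xs\<close>,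
  which determines it.\<close>

lemma map_sort_key: "map f (sort_key f xs) = sort (map f xs)"
  by (rule properties_for_sort[symmetric]) auto

text \<open>Both compared blocks are members of \<open>Cs\<close>, on which \<open>Min\<close> is
  injective, so applying \<open>Min\<close> loses nothing; \<open>map_sort_key\<close> then turns
  the minima of the sorted blocks into the sorted minima.\<close>

lemma deranged_iff:
  assumes "ordered_set_partition n Cs"
  shows "deranged n Cs \<longleftrightarrow>
    (\<forall>i\<in>{1..length Cs}. map Min Cs ! (i - 1) \<noteq> sort (map Min Cs) ! (i - 1))"
proof -
  have "Cs ! (i - 1) = sort_key Min Cs ! (i - 1) \<longleftrightarrow>
      map Min Cs ! (i - 1) = sort (map Min Cs) ! (i - 1)" if "i \<in> {1..length Cs}" for i
  proof -
    have i: "i - 1 < length Cs"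
      using that by auto
    then have "Cs ! (i - 1) \<in> set Cs" "sort_key Min Cs ! (i - 1) \<in> set Cs"
      by (simp, metis length_sort nth_mem set_sort)
    from inj_on_eq_iff[OF inj_on_Min_ordered_set_partition[OF assms] this] i
    show ?thesis
      by (simp flip: map_sort_key)
  qed
  then show ?thesis
    using assms by (auto simp: deranged_def)
qed

theorem proposition3p3:
  fixes n :: nat and \<alpha> :: "nat list"
  assumes "\<alpha> \<in> UPF n"
  shows "\<alpha> \<in> DUPF n \<longleftrightarrow>
    (\<forall>j\<in>{1..num_blocks \<alpha>}.
       leader \<alpha> j \<noteq> sort (map (leader \<alpha>) [1..<num_blocks \<alpha> + 1]) ! (j - 1))"
proof -
  have leaders: "map (leader \<alpha>) [1..<num_blocks \<alpha> + 1] = map Min (phi \<alpha>)"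
    by (rule nth_equalityI) (auto simp: leader_def length_phi simp del: upt_Suc)
  have "ordered_set_partition n (phi \<alpha>)"
    using assms by (intro ordered_set_partition_phi) (simp add: UPF_def)
  from deranged_iff[OF this] have "\<alpha> \<in> DUPF n \<longleftrightarrow>
      (\<forall>j\<in>{1..num_blocks \<alpha>}. map Min (phi \<alpha>) ! (j - 1) \<noteq> sort (map Min (phi \<alpha>)) ! (j - 1))"
    using assms by (simp add: DUPF_def length_phi)
  also have "\<dots> \<longleftrightarrow> (\<forall>j\<in>{1..num_blocks \<alpha>}. leader \<alpha> j \<noteq> sort (map Min (phi \<alpha>)) ! (j - 1))"
    by (intro ball_cong) (auto simp: leader_def length_phi)
  finally show ?thesis
    unfolding leaders .
qed

end
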